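(* Let $M\subset\mathbb R^3$ be a face-connected model consisting of $V$ unit cubes. Then the fourfold enlargement $4M=\{4x : x\in M\}$ has an exact tiling by upright $2\times4\times1$ bricks whose contact graph is connected, and which uses exactly $8V$ bricks. Moreover, no smaller positive real enlargement factor works for every face-connected model: for every real number $r$ with $0<r<4$ there is a face-connected model $M$ such that $rM=\{rx : x\in M\}$ has no exact tiling by upright $2\times4\times1$ bricks with connected contact graph.
   Context: A model is a finite, nonempty union $M\subset\mathbb R^3$ of unit cubes $[a,a+1]\times[b,b+1]\times[c,c+1]$ with $(a,b,c)\in\mathbb Z^3$; $V$ denotes the number of these cubes. The model is face-connected if any two of its cubes can be joined by a chain of cubes of the model in which consecutive cubes share a (two-dimensional) face. The third coordinate is the height. An upright $2\times4\times1$ brick is a translate by a vector of $\mathbb Z^3$ of $[0,4]\times[0,2]\times[0,1]$ or of $[0,2]\times[0,4]\times[0,1]$. An exact tiling of a region $R\subset\mathbb R^3$ by such bricks is a finite collection of such bricks with pairwise disjoint interiors whose union is exactly $R$. The footprint of a brick is its projection to the first two coordinates. Two bricks of a tiling have a contact when they lie in consecutive height layers (their third-coordinate intervals are $[h,h+1]$ and $[h+1,h+2]$ for some integer $h$) and their footprints overlap in at least one unit square with vertices in $\mathbb Z^2$. The contact graph of a tiling has the bricks as vertices, with two bricks adjacent when they have a contact. *)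

theory Defs
  imports "HOL-Analysis.Analysis"
begin

definition unit_cubes :: "(real^3) set set" where
  "unit_cubes = {cbox (vector [of_int a, of_int b, of_int c])
                      (vector [of_int a + 1, of_int b + 1, of_int c + 1]) | a b c :: int. True}"

text \<open>The family of cubes \<open>Q\<close> is carried along with the point set \<open>M\<close>, so that the number
  of cubes of the model is \<open>card Q\<close>.\<close>

definition model :: "(real^3) set set \<Rightarrow> (real^3) set \<Rightarrow> bool" where
  "model Q M \<longleftrightarrow> finite Q \<and> Q \<noteq> {} \<and> Q \<subseteq> unit_cubes \<and> M = \<Union>Q"

definition chain_connected :: "'a set \<Rightarrow> ('a \<Rightarrow> 'a \<Rightarrow> bool) \<Rightarrow> bool" where
  "chain_connected S E \<longleftrightarrow>
     (\<forall>A\<in>S. \<forall>B\<in>S. (A, B) \<in> {(X, Y). X \<in> S \<and> Y \<in> S \<and> E X Y}\<^sup>*)"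

definition share_face :: "(real^3) set \<Rightarrow> (real^3) set \<Rightarrow> bool" where
  "share_face A B \<longleftrightarrow> (\<exists>F. F face_of A \<and> F face_of B \<and> aff_dim F = 2)"

definition face_connected :: "(real^3) set set \<Rightarrow> bool" where
  "face_connected Q \<longleftrightarrow> chain_connected Q share_face"

definition bricks :: "(real^3) set set" where
  "bricks = {(\<lambda>x. v + x) ` B | v B. (\<forall>i. v $ i \<in> \<int>) \<and>
               B \<in> {cbox 0 (vector [4, 2, 1]), cbox 0 (vector [2, 4, 1])}}"

definition exact_tiling :: "(real^3) set set \<Rightarrow> (real^3) set \<Rightarrow> bool" where
  "exact_tiling T R \<longleftrightarrow> finite T \<and> T \<subseteq> bricks \<and>
     pairwise (\<lambda>A B. interior A \<inter> interior B = {}) T \<and> \<Union>T = R"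

definition footprint :: "(real^3) set \<Rightarrow> (real^2) set" where
  "footprint B = (\<lambda>x. vector [x $ 1, x $ 2]) ` B"

definition height_interval :: "(real^3) set \<Rightarrow> real set" where
  "height_interval B = (\<lambda>x. x $ 3) ` B"

definition directly_below :: "(real^3) set \<Rightarrow> (real^3) set \<Rightarrow> bool" where
  "directly_below A B \<longleftrightarrow> (\<exists>h::int. height_interval A = {of_int h .. of_int h + 1} \<and>
                                   height_interval B = {of_int h + 1 .. of_int h + 2})"

definition contact :: "(real^3) set \<Rightarrow> (real^3) set \<Rightarrow> bool" where
  "contact A B \<longleftrightarrow> (directly_below A B \<or> directly_below B A) \<and>
     (\<exists>a b :: int. cbox (vector [of_int a, of_int b]) (vector [of_int a + 1, of_int b + 1])
                     \<subseteq> footprint A \<inter> footprint B)"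

definition contact_graph_connected :: "(real^3) set set \<Rightarrow> bool" where
  "contact_graph_connected T \<longleftrightarrow> chain_connected T contact"

end

theory Submission
  imports Defs
begin

text \<open>
  The enlargement cuts each cube of the model into four layers of height one, and each layer into
  four \<open>2 \<times> 2\<close> squares, the quarters. An upright brick that respects this grid is a domino of two
  side-adjacent quarters, so tilings become perfect matchings of quarters, one for each layer.

  The bricks of one cube are easily linked: matching the four quarters horizontally in one layer
  and vertically in the next makes every brick touch every brick above it. Cubes that share a
  horizontal face are linked at once too, because their bricks overlap. The difficulty is a pair of
  cubes side by side, whose footprints are disjoint: some brick has to straddle their common wall.

  Around the quarters of a single cube runs a 4-cycle, the union of the two matchings. If two side
  by side cubes are to be joined, the two edges of their cycles that run along the common wall are
  exchanged for the two edges that cross it. This merges the cycles, as it does when one draws a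
  closed curve around a tree, and it can be done inside a single one of the two matchings: the one
  that contains the edges along north and south walls, or the one that contains the edges along
  east and west walls. Hence for every set \<open>J\<close> of joined pairs there are two matchings, \<open>ns J\<close> and
  \<open>ew J\<close>, given by a local rule, and alternating them over the layers gives a tiling.

  Its contact graph is connected if the two matchings together with vertical adjacency connect all
  quarters (\<open>contact_graph_connected_brick_image\<close>). Arbitrary \<open>J\<close> will not do, since a closed circuit of
  joined cubes would produce an inner and an outer curve. The pairs are therefore chosen while the
  model grows one cube at a time, each new cube being joined to one old neighbour only
  (\<open>linked_attach\<close>, \<open>linked_exists\<close>); then the new cube just adds a detour to an existing curve.

  No factor below 4 is enough even for a single cube, because a brick of length 4 does not fit.
\<close>


section \<open>Two matchings of the quarter squares\<close>

text \<open>Integer triples play three roles, and each coordinate change below passes between them: the lattice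
  position of a cube of the model; a quarter column \<open>(i, j, c)\<close>, with \<open>i\<close> and \<open>j\<close> in units of half a cube
  and \<open>c\<close> the height of the cube; and a unit \<open>(i, j, h)\<close>, a \<open>2 \<times> 2 \<times> 1\<close> box whose height \<open>h\<close> counts
  layers of the enlargement.\<close>

type_synonym cell = "int \<times> int \<times> int"

text \<open>The two halves of a cube in one direction have coordinates \<open>2 * a\<close> and \<open>2 * a + 1\<close>. The two
  neighbours of a half are its \<open>twin\<close> in the same cube and the half \<open>across\<close> the wall.\<close>

definition twin :: "int \<Rightarrow> int" where
  "twin i = (if even i then i + 1 else i - 1)"

definition across :: "int \<Rightarrow> int" where
  "across i = (if even i then i - 1 else i + 1)"

lemma twin_twin [simp]: "twin (twin i) = i"
  and across_across [simp]: "across (across i) = i"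
  and twin_div [simp]: "twin i div 2 = i div 2"
  and across_div_neq [simp]: "across i div 2 \<noteq> i div 2"
  and across_twin_div_neq [simp]: "across (twin i) div 2 \<noteq> across i div 2"
  by (auto simp: twin_def across_def) presburger+

lemma twin_neq [simp]: "twin i \<noteq> i" and across_neq [simp]: "across i \<noteq> i"
  by (auto simp: twin_def across_def)

lemma same_div_cases: "i div 2 = j div 2 \<Longrightarrow> i = j \<or> i = twin j"
  unfolding twin_def by presburger

text \<open>A half is determined by its cube and the cube on the other side of its wall.\<close>

lemma eq_if_same_sides: "i div 2 = j div 2 \<Longrightarrow> across i div 2 = across j div 2 \<Longrightarrow> i = j"
  using same_div_cases[of i j] across_twin_div_neq[of j] by metis

fun cell_of :: "cell \<Rightarrow> cell" where
  "cell_of (i, j, c) = (i div 2, j div 2, c)"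

text \<open>Without joins, \<open>ns\<close> matches along the north and south walls of a cube, and \<open>ew\<close> along its east and west
  walls; a joined wall is crossed instead.\<close>

fun ns :: "(cell \<times> cell) set \<Rightarrow> cell \<Rightarrow> cell" where
  "ns J (i, j, c) =
     (if (cell_of (i, j, c), cell_of (i, across j, c)) \<in> J then (i, across j, c) else (twin i, j, c))"

fun ew :: "(cell \<times> cell) set \<Rightarrow> cell \<Rightarrow> cell" where
  "ew J (i, j, c) =
     (if (cell_of (i, j, c), cell_of (across i, j, c)) \<in> J then (across i, j, c) else (i, twin j, c))"

fun step :: "(cell \<times> cell) set \<Rightarrow> cell \<Rightarrow> cell \<Rightarrow> bool" where
  "step J (i, j, c) (i', j', c') \<longleftrightarrow>
     ns J (i, j, c) = (i', j', c') \<or> ew J (i, j, c) = (i', j', c') \<or>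
     (i = i' \<and> j = j' \<and> \<bar>c - c'\<bar> = 1)"

definition quarters :: "cell set \<Rightarrow> cell set" where
  "quarters S = {p. cell_of p \<in> S}"

lemma ns_ns: "sym J \<Longrightarrow> ns J (ns J p) = p"
  by (cases p) (auto dest: symD)

lemma ew_ew: "sym J \<Longrightarrow> ew J (ew J p) = p"
  by (cases p) (auto dest: symD)

lemma ns_in_quarters: "J \<subseteq> S \<times> S \<Longrightarrow> p \<in> quarters S \<Longrightarrow> ns J p \<in> quarters S"
  by (cases p) (auto simp: quarters_def)

lemma ew_in_quarters: "J \<subseteq> S \<times> S \<Longrightarrow> p \<in> quarters S \<Longrightarrow> ew J p \<in> quarters S"
  by (cases p) (auto simp: quarters_def)

lemma step_sym: "sym J \<Longrightarrow> step J p q \<Longrightarrow> step J q p"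
  using ns_ns[of J p] ew_ew[of J p] by (cases p; cases q) (force simp del: ns.simps ew.simps)

lemma chain_sym:
  assumes "\<And>p q. E p q \<Longrightarrow> E q p"
    and "(p, q) \<in> {(X, Y). X \<in> S \<and> Y \<in> S \<and> E X Y}\<^sup>*"
  shows "(q, p) \<in> {(X, Y). X \<in> S \<and> Y \<in> S \<and> E X Y}\<^sup>*"
proof -
  have "sym {(X, Y). X \<in> S \<and> Y \<in> S \<and> E X Y}" using assms(1) by (auto intro: symI)
  then show ?thesis using assms(2) sym_rtrancl by (metis symD)
qed

text \<open>Links of the old structure may disappear, provided that a detour replaces them; and it is enough to
  reach the old part from each new point.\<close>

lemma chain_connected_extend:
  assumes sym: "\<And>p q. E' p q \<Longrightarrow> E' q p"
    and conn: "chain_connected S E"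
    and sub: "S \<subseteq> S'"
    and old: "\<And>p q. p \<in> S \<Longrightarrow> q \<in> S \<Longrightarrow> E p q \<Longrightarrow>
      (p, q) \<in> {(X, Y). X \<in> S' \<and> Y \<in> S' \<and> E' X Y}\<^sup>*"
    and new: "\<And>p. p \<in> S' - S \<Longrightarrow>
      \<exists>q\<in>S. (p, q) \<in> {(X, Y). X \<in> S' \<and> Y \<in> S' \<and> E' X Y}\<^sup>*"
  shows "chain_connected S' E'"
proof -
  let ?R = "{(X, Y). X \<in> S' \<and> Y \<in> S' \<and> E' X Y}\<^sup>*"
  have oldconn: "(p, q) \<in> ?R" if "p \<in> S" "q \<in> S" for p q
  proof -
    have "{(X, Y). X \<in> S \<and> Y \<in> S \<and> E X Y}\<^sup>* \<subseteq> ?R"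
      by (rule rtrancl_subset_rtrancl) (use old in blast)
    then show ?thesis using conn that unfolding chain_connected_def by blast
  qed
  have to_old: "\<exists>q\<in>S. (p, q) \<in> ?R" if "p \<in> S'" for p
    using new[of p] that by (cases "p \<in> S") auto
  show ?thesis unfolding chain_connected_def
  proof (intro ballI)
    fix p q assume "p \<in> S'" "q \<in> S'"
    then obtain p' q' where 1: "p' \<in> S" "(p, p') \<in> ?R" and 2: "q' \<in> S" "(q, q') \<in> ?R"
      using to_old by meson
    have "(q', q) \<in> ?R" by (rule chain_sym[OF sym 2(2)])
    with oldconn[OF 1(1) 2(1)] have "(p', q) \<in> ?R" by (rule rtrancl_trans)
    with 1(2) show "(p, q) \<in> ?R" by (rule rtrancl_trans)
  qed
qed

text \<open>The invariant of the growth. Inclusion in \<open>S \<times> S\<close> ensures that no brick leaves the model and that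
  joins do not involve a cube that has yet to be added.\<close>

definition linked :: "cell set \<Rightarrow> (cell \<times> cell) set \<Rightarrow> bool" where
  "linked S J \<longleftrightarrow> sym J \<and> J \<subseteq> S \<times> S \<and> chain_connected (quarters S) (step J)"

lemma linked_single: "linked {s} {}"
proof -
  obtain a b c where s: "s = (a, b, c)" by (cases s)
  let ?R = "{(X, Y). X \<in> quarters {s} \<and> Y \<in> quarters {s} \<and> step {} X Y}"
  have mem: "(i, j, d) \<in> quarters {s} \<longleftrightarrow> i div 2 = a \<and> j div 2 = b \<and> d = c" for i j d
    by (auto simp: quarters_def s)
  have 1: "((i, j, c), (twin i, j, c)) \<in> ?R\<^sup>*" "((i, j, c), (i, twin j, c)) \<in> ?R\<^sup>*"
    if "i div 2 = a" "j div 2 = b" for i j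
    using that by (auto intro!: r_into_rtrancl simp: mem)
  have 2: "((i, j, c), (i', j', c)) \<in> ?R\<^sup>*"
    if "i div 2 = a" "j div 2 = b" "i' div 2 = a" "j' div 2 = b" for i j i' j'
  proof -
    have "((i, j, c), (i', j, c)) \<in> ?R\<^sup>*"
      using 1(1)[of i j] same_div_cases[of i' i] that by auto
    moreover have "((i', j, c), (i', j', c)) \<in> ?R\<^sup>*"
      using 1(2)[of i' j] same_div_cases[of j' j] that by auto
    ultimately show ?thesis by (rule rtrancl_trans)
  qed
  then have "chain_connected (quarters {s}) (step {})"
    unfolding chain_connected_def by (auto simp: mem)
  then show ?thesis unfolding linked_def by (auto simp: sym_def)
qed

text \<open>A cube on top of or below an old one needs no new join: each of its quarters is vertically adjacent
  to an old quarter.\<close>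

lemma linked_attach_vertical:
  assumes "linked S J" and y: "(a, b, c) \<in> S" and x: "(a, b, c') \<notin> S" and cc: "\<bar>c - c'\<bar> = 1"
  shows "linked (insert (a, b, c') S) J"
proof -
  have J: "sym J" "J \<subseteq> S \<times> S" "chain_connected (quarters S) (step J)"
    using assms(1) unfolding linked_def by auto
  let ?S = "insert (a, b, c') S"
  let ?R = "{(X, Y). X \<in> quarters ?S \<and> Y \<in> quarters ?S \<and> step J X Y}"
  have "chain_connected (quarters ?S) (step J)"
  proof (rule chain_connected_extend[OF step_sym[OF J(1)] J(3)])
    show "quarters S \<subseteq> quarters ?S" by (auto simp: quarters_def)
    show "(p, q) \<in> ?R\<^sup>*" if "p \<in> quarters S" "q \<in> quarters S" "step J p q" for p q
      using that by (auto simp: quarters_def)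
    show "\<exists>q\<in>quarters S. (p, q) \<in> ?R\<^sup>*" if pnew: "p \<in> quarters ?S - quarters S" for p
    proof -
      obtain i j where p: "p = (i, j, c')" "i div 2 = a" "j div 2 = b"
        using pnew by (cases p) (auto simp: quarters_def)
      have "(p, (i, j, c)) \<in> ?R" "(i, j, c) \<in> quarters S"
        using p y cc by (auto simp: quarters_def)
      then show ?thesis by blast
    qed
  qed
  then show ?thesis using J unfolding linked_def by auto
qed

text \<open>Joining the new cube breaks exactly one \<open>ns\<close> pair of the old cube, namely the pair of quarters along
  the common wall. These two stay connected by going around the new cube through all its four
  quarters, which also connects the new cube to the old ones.\<close>

lemma linked_attach_ns:
  assumes "linked S J" and y: "(a, b, c) \<in> S" and x: "(a, b', c) \<notin> S" and bb: "\<bar>b - b'\<bar> = 1"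
  shows "\<exists>J'. linked (insert (a, b', c) S) J'"
proof -
  have J: "sym J" "J \<subseteq> S \<times> S" "chain_connected (quarters S) (step J)"
    using assms(1) unfolding linked_def by auto
  let ?x = "(a, b', c)" and ?y = "(a, b, c)"
  let ?S = "insert ?x S"
  define J' where "J' = J \<union> {(?x, ?y), (?y, ?x)}"
  let ?R = "{(X, Y). X \<in> quarters ?S \<and> Y \<in> quarters ?S \<and> step J' X Y}"
  have symJ': "sym J'" using J(1) unfolding J'_def by (auto simp: sym_def)
  have subJ': "J' \<subseteq> ?S \<times> ?S" using J(2) y unfolding J'_def by auto
  \<comment> \<open>the row of quarters of the old cube along the common wall; row k lies opposite\<close>
  obtain j where j: "j div 2 = b" "across j div 2 = b'"
  proof (cases "b' = b + 1")
    case True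
    then show ?thesis using that[of "2 * b + 1"] by (auto simp: across_def)
  next
    case False
    then have "b' = b - 1" using bb by auto
    then show ?thesis using that[of "2 * b"] by (auto simp: across_def)
  qed
  define k where "k = across j"
  have k: "k div 2 = b'" "across k = j" using j by (auto simp: k_def)
  have notJ: "(?x, s) \<notin> J" "(s, ?x) \<notin> J" for s using J(2) x by auto
  have bneq: "b' \<noteq> b" using bb by auto
  have mem: "(i, j, c) \<in> quarters ?S" "(i, k, c) \<in> quarters ?S" "(i, twin k, c) \<in> quarters ?S"
    if "i div 2 = a" for i using that j k y by (auto simp: quarters_def)
  have nsj: "ns J' (i, j, c) = (i, k, c)" if "i div 2 = a" for i
    using that j by (simp add: J'_def k_def)
  have ewk: "ew J' (i, k, c) = (i, twin k, c)" if "i div 2 = a" for i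
    using that k bneq notJ by (simp add: J'_def)
  \<comment> \<open>the far wall of the new cube is not joined, because its only join is to the old cube\<close>
  have nst: "ns J' (i, twin k, c) = (twin i, twin k, c)" if "i div 2 = a" for i
    using that k bneq notJ across_twin_div_neq[of k] j by (simp add: J'_def)
  have e1: "((i, j, c), (i, k, c)) \<in> ?R" if "i div 2 = a" for i
    using mem nsj that by (simp del: ns.simps ew.simps)
  have e2: "((i, k, c), (i, twin k, c)) \<in> ?R" if "i div 2 = a" for i
    using mem ewk that by (simp del: ns.simps ew.simps)
  have e3: "((i, twin k, c), (twin i, twin k, c)) \<in> ?R" if "i div 2 = a" for i
    using mem[of i] mem(3)[of "twin i"] nst that by (simp del: ns.simps ew.simps)
  have symR: "(p, q) \<in> ?R\<^sup>* \<Longrightarrow> (q, p) \<in> ?R\<^sup>*" for p q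
    by (rule chain_sym[OF step_sym[OF symJ']])
  have down: "((i, j, c), (i, twin k, c)) \<in> ?R\<^sup>*" if "i div 2 = a" for i
    by (rule converse_rtrancl_into_rtrancl[OF e1[OF that] r_into_rtrancl[OF e2[OF that]]])
  have detour: "((i, j, c), (twin i, j, c)) \<in> ?R\<^sup>*" if i: "i div 2 = a" for i
  proof -
    have "twin i div 2 = a" using i by simp
    then have "((twin i, twin k, c), (twin i, j, c)) \<in> ?R\<^sup>*" by (rule symR[OF down])
    with rtrancl_into_rtrancl[OF down[OF i] e3[OF i]] show ?thesis by (rule rtrancl_trans)
  qed
  have "chain_connected (quarters ?S) (step J')"
  proof (rule chain_connected_extend[OF step_sym[OF symJ'] J(3)])
    show "quarters S \<subseteq> quarters ?S" by (auto simp: quarters_def)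
    show "(p, q) \<in> ?R\<^sup>*" if "p \<in> quarters S" "q \<in> quarters S" "step J p q" for p q
    proof -
      obtain i l d where p: "p = (i, l, d)" by (cases p)
      have cp: "cell_of p \<noteq> ?x" using that(1) x by (auto simp: quarters_def)
      have inS: "p \<in> quarters ?S" "q \<in> quarters ?S" using that by (auto simp: quarters_def)
      show ?thesis
      \<comment> \<open>the only kind of link that the new join destroys\<close>
      proof (cases "cell_of p = ?y \<and> l = j \<and> q = ns J p")
        case True
        then have "q = (twin i, j, c)" "p = (i, j, c)" "i div 2 = a"
          using notJ p j by auto
        then show ?thesis using detour by simp
      next
        case False
        have "step J' p q"
        proof -
          have "ew J' p = ew J p"
            using cp bneq p by (auto simp: J'_def)
          moreover have "ns J' p = ns J p" if "q = ns J p"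
          proof -
            have "\<not> (cell_of p = ?y \<and> across l div 2 = b')"
              using False that p j eq_if_same_sides[of l j] by auto
            then show ?thesis using cp p by (auto simp: J'_def)
          qed
          ultimately show ?thesis using that(3) p
            by (cases q) (auto simp del: ns.simps ew.simps)
        qed
        then show ?thesis using inS by blast
      qed
    qed
    show "\<exists>q\<in>quarters S. (p, q) \<in> ?R\<^sup>*" if pnew: "p \<in> quarters ?S - quarters S" for p
    proof -
      obtain i l where p: "p = (i, l, c)" "i div 2 = a" "l div 2 = b'"
        using pnew by (cases p) (auto simp: quarters_def)
      have "l = k \<or> l = twin k" using same_div_cases[of l k] p k by simp
      then have "((i, j, c), p) \<in> ?R\<^sup>*"
        using down[OF p(2)] r_into_rtrancl[OF e1[OF p(2)]] unfolding p(1) by (elim disjE) simp_all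
      then have "(p, (i, j, c)) \<in> ?R\<^sup>*" by (rule symR)
      moreover have "(i, j, c) \<in> quarters S" using p(2) j y by (auto simp: quarters_def)
      ultimately show ?thesis by blast
    qed
  qed
  then show ?thesis using symJ' subJ' unfolding linked_def by blast
qed

text \<open>Exchanging the two horizontal directions exchanges \<open>ns\<close> and \<open>ew\<close>, so the east-west case of attaching
  a cube follows from the north-south case.\<close>

fun swap :: "cell \<Rightarrow> cell" where
  "swap (i, j, c) = (j, i, c)"

lemma swap_swap [simp]: "swap (swap p) = p"
  by (cases p) auto

lemma swap_in_swap [simp]: "swap p \<in> swap ` S \<longleftrightarrow> p \<in> S"
  by (metis image_iff swap_swap)

lemma linked_swap:
  assumes "linked S J"
  shows "linked (swap ` S) (map_prod swap swap ` J)"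
proof -
  let ?S = "swap ` S" and ?J = "map_prod swap swap ` J"
  have J: "sym J" "J \<subseteq> S \<times> S" "chain_connected (quarters S) (step J)"
    using assms unfolding linked_def by auto
  have inJ: "(swap p, swap q) \<in> ?J \<longleftrightarrow> (p, q) \<in> J" for p q
  proof
    assume "(swap p, swap q) \<in> ?J"
    then obtain u v where "(u, v) \<in> J" "swap p = swap u" "swap q = swap v" by auto
    then show "(p, q) \<in> J" by (metis swap_swap)
  qed (auto intro: rev_image_eqI)
  have inJ': "((x, y, z), (x', y', z')) \<in> ?J \<longleftrightarrow> ((y, x, z), (y', x', z')) \<in> J" for x y z x' y' z'
    using inJ[of "(y, x, z)" "(y', x', z')"] by simp
  have st: "step ?J (swap p) (swap q) \<longleftrightarrow> step J p q" for p q
    by (cases p; cases q) (auto simp: inJ')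
  have qu: "swap p \<in> quarters ?S \<longleftrightarrow> p \<in> quarters S" for p
    using swap_in_swap[of "cell_of p" S] by (cases p) (auto simp: quarters_def)
  let ?R = "{(X, Y). X \<in> quarters S \<and> Y \<in> quarters S \<and> step J X Y}"
  let ?R' = "{(X, Y). X \<in> quarters ?S \<and> Y \<in> quarters ?S \<and> step ?J X Y}"
  have move: "(swap p, swap q) \<in> ?R'\<^sup>*" if "(p, q) \<in> ?R\<^sup>*" for p q
    using that
  proof induction
    case (step y z)
    then have "(swap y, swap z) \<in> ?R'" by (simp add: st qu)
    with step.IH show ?case by (rule rtrancl_into_rtrancl)
  qed simp
  have "chain_connected (quarters ?S) (step ?J)"
    unfolding chain_connected_def
  proof (intro ballI)
    fix p q assume "p \<in> quarters ?S" "q \<in> quarters ?S"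
    then have "swap p \<in> quarters S" "swap q \<in> quarters S"
      using qu[of "swap p"] qu[of "swap q"] by simp_all
    then have "(swap p, swap q) \<in> ?R\<^sup>*" using J(3) unfolding chain_connected_def by blast
    from move[OF this] show "(p, q) \<in> ?R'\<^sup>*" by simp
  qed
  moreover have "sym ?J" using J(1) by (auto simp: sym_def inJ')
  moreover have "?J \<subseteq> ?S \<times> ?S" using J(2) by auto
  ultimately show ?thesis unfolding linked_def by auto
qed

lemma linked_attach_ew:
  assumes "linked S J" and "(a, b, c) \<in> S" and "(a', b, c) \<notin> S" and "\<bar>a - a'\<bar> = 1"
  shows "\<exists>J'. linked (insert (a', b, c) S) J'"
proof -
  have "(b, a, c) \<in> swap ` S" "(b, a', c) \<notin> swap ` S"
    using assms(2,3) swap_in_swap[of "(a, b, c)"] swap_in_swap[of "(a', b, c)"] by simp_all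
  then obtain J' where "linked (insert (b, a', c) (swap ` S)) J'"
    using linked_attach_ns[OF linked_swap[OF assms(1)]] assms(4) by blast
  from linked_swap[OF this] show ?thesis by (auto simp: image_image)
qed

section \<open>Growing the model cube by cube\<close>

text \<open>Equality is included because a cube shares a face with itself.\<close>

fun near :: "cell \<Rightarrow> cell \<Rightarrow> bool" where
  "near (a, b, c) (a', b', c') \<longleftrightarrow> \<bar>a - a'\<bar> + \<bar>b - b'\<bar> + \<bar>c - c'\<bar> \<le> 1"

lemma linked_attach:
  assumes "linked S J" "y \<in> S" "x \<notin> S" "near y x"
  shows "\<exists>J'. linked (insert x S) J'"
proof -
  obtain a b c a' b' c' where y: "y = (a, b, c)" and x: "x = (a', b', c')"
    by (cases y; cases x)
  have "\<not> (a = a' \<and> b = b' \<and> c = c')" using assms y x by auto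
  then consider "\<bar>a - a'\<bar> = 1" "b' = b" "c' = c" | "a' = a" "\<bar>b - b'\<bar> = 1" "c' = c"
    | "a' = a" "b' = b" "\<bar>c - c'\<bar> = 1"
    using assms(4) unfolding x y near.simps by (smt (verit))
  then show ?thesis
  proof cases
    case 1
    then show ?thesis using linked_attach_ew[of S J a b c a'] assms(1-3) by (simp add: x y)
  next
    case 2
    then show ?thesis using linked_attach_ns[of S J a b c b'] assms(1-3) by (simp add: x y)
  next
    case 3
    then have "linked (insert x S) J"
      using linked_attach_vertical[of S J a b c c'] assms(1-3) by (simp add: x y)
    then show ?thesis ..
  qed
qed

lemma chain_connected_crosses:
  assumes "chain_connected S E" "P \<subseteq> S" "P \<noteq> {}" "P \<noteq> S"
  shows "\<exists>y\<in>P. \<exists>x\<in>S - P. E y x"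
proof (rule ccontr)
  assume none: "\<not> ?thesis"
  obtain y x where y: "y \<in> P" and x: "x \<in> S" "x \<notin> P" using assms by blast
  have "(y, x) \<in> {(X, Y). X \<in> S \<and> Y \<in> S \<and> E X Y}\<^sup>*"
    using assms x y unfolding chain_connected_def by blast
  then have "x \<in> P"
    by induction (use y none in auto)
  with x show False by simp
qed

text \<open>In a maximal linked part, any cube next to it could still be attached; by connectedness there is
  such a cube unless the part is everything.\<close>

lemma linked_exists:
  assumes "finite S" "S \<noteq> {}" "chain_connected S near"
  shows "\<exists>J. linked S J"
proof -
  define F where "F = {P. P \<subseteq> S \<and> (\<exists>J. linked P J)}"
  obtain s where "s \<in> S" using assms by blast
  then have sF: "{s} \<in> F" using linked_single unfolding F_def by blast
  have "finite F" using assms(1) unfolding F_def by simp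
  then obtain P where P: "P \<in> F" "\<And>P'. P' \<in> F \<Longrightarrow> P \<subseteq> P' \<Longrightarrow> P = P'" "{s} \<subseteq> P"
    using finite_has_maximal2[OF _ sF] by blast
  have "P = S"
  proof (rule ccontr)
    assume "P \<noteq> S"
    have "P \<subseteq> S" "P \<noteq> {}" using P unfolding F_def by auto
    with \<open>P \<noteq> S\<close> obtain y x where "y \<in> P" "x \<in> S - P" "near y x"
      using chain_connected_crosses[OF assms(3)] by blast
    moreover obtain J where "linked P J" using P(1) unfolding F_def by blast
    ultimately have "\<exists>J'. linked (insert x P) J'" using linked_attach[of P J y x] by blast
    then have "insert x P \<in> F" using \<open>P \<subseteq> S\<close> \<open>x \<in> S - P\<close> unfolding F_def by blast
    then show False using P(2)[of "insert x P"] \<open>x \<in> S - P\<close> by blast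
  qed
  then show ?thesis using P(1) unfolding F_def by blast
qed

section \<open>From matchings to bricks\<close>

fun quarter_of :: "cell \<Rightarrow> cell" where
  "quarter_of (i, j, h) = (i, j, h div 4)"

definition units :: "cell set \<Rightarrow> cell set" where
  "units S = {u. quarter_of u \<in> quarters S}"

fun relayer :: "int \<Rightarrow> cell \<Rightarrow> cell" where
  "relayer h (i, j, c) = (i, j, h)"

text \<open>The two matchings alternate with the parity of the layer. As a cube is enlarged to four layers,
  its lowest layer is even and both matchings occur within each cube.\<close>

fun mate :: "(cell \<times> cell) set \<Rightarrow> cell \<Rightarrow> cell" where
  "mate J (i, j, h) = relayer h (if even h then ns J (i, j, h div 4) else ew J (i, j, h div 4))"

lemma ns_height: "ns J (i, j, c) = (i', j', c') \<Longrightarrow> c' = c"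
  by (auto split: if_splits)

lemma ew_height: "ew J (i, j, c) = (i', j', c') \<Longrightarrow> c' = c"
  by (auto split: if_splits)

lemma same_height:
  obtains i' j' where "(if even h then ns J (i, j, c) else ew J (i, j, c)) = (i', j', c)"
proof (cases "even h")
  case True
  then show ?thesis using that ns_height[of J i j c] by (cases "ns J (i, j, c)") (simp del: ns.simps)
next
  case False
  then show ?thesis using that ew_height[of J i j c] by (cases "ew J (i, j, c)") (simp del: ew.simps)
qed

lemma mate_mate:
  assumes "sym J" shows "mate J (mate J u) = u"
proof -
  obtain i j h where u: "u = (i, j, h)" by (cases u)
  obtain i' j' where *: "(if even h then ns J (i, j, h div 4) else ew J (i, j, h div 4)) = (i', j', h div 4)"
    by (rule same_height[where J = J and i = i and j = j and c = "h div 4" and h = h])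
  then have "(if even h then ns J (i', j', h div 4) else ew J (i', j', h div 4)) = (i, j, h div 4)"
    using ns_ns[OF assms, of "(i, j, h div 4)"] ew_ew[OF assms, of "(i, j, h div 4)"]
    by (simp split: if_splits del: ns.simps ew.simps)
  with * show ?thesis by (simp add: u del: ns.simps ew.simps)
qed

lemma mate_in_units:
  assumes "J \<subseteq> S \<times> S" "u \<in> units S" shows "mate J u \<in> units S"
proof -
  obtain i j h where u: "u = (i, j, h)" by (cases u)
  obtain i' j' where *: "(if even h then ns J (i, j, h div 4) else ew J (i, j, h div 4)) = (i', j', h div 4)"
    by (rule same_height[where J = J and i = i and j = j and c = "h div 4" and h = h])
  have "(i', j', h div 4) \<in> quarters S"
    using ns_in_quarters[OF assms(1), of "(i, j, h div 4)"]
      ew_in_quarters[OF assms(1), of "(i, j, h div 4)"] assms(2) *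
    by (simp add: u units_def split: if_splits del: ns.simps ew.simps)
  with * show ?thesis by (simp add: u units_def del: ns.simps ew.simps)
qed

lemma mate_cases:
  obtains "mate J (i, j, h) = (i + 1, j, h)" | "mate J (i, j, h) = (i - 1, j, h)"
    | "mate J (i, j, h) = (i, j + 1, h)" | "mate J (i, j, h) = (i, j - 1, h)"
proof -
  have "mate J (i, j, h) \<in> {(twin i, j, h), (i, twin j, h), (across i, j, h), (i, across j, h)}"
    by auto
  moreover have "twin k = k + 1 \<or> twin k = k - 1" "across k = k + 1 \<or> across k = k - 1" for k
    by (simp_all add: twin_def across_def)
  ultimately show ?thesis using that by (metis empty_iff insert_iff)
qed

lemma mate_neq: "mate J u \<noteq> u"
  by (cases u) auto

fun qbox :: "cell \<Rightarrow> (real^3) set" where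
  "qbox (i, j, h) = cbox (vector [2 * of_int i, 2 * of_int j, of_int h])
     (vector [2 * of_int i + 2, 2 * of_int j + 2, of_int h + 1])"

fun cube :: "cell \<Rightarrow> (real^3) set" where
  "cube (a, b, c) = cbox (vector [of_int a, of_int b, of_int c])
     (vector [of_int a + 1, of_int b + 1, of_int c + 1])"

definition brick :: "(cell \<times> cell) set \<Rightarrow> cell \<Rightarrow> (real^3) set" where
  "brick J u = qbox u \<union> qbox (mate J u)"

text \<open>The half-open variant of the grid of units, which assigns each point to exactly one unit. It replaces
  boundary considerations: an interior point of a brick is assigned to one of the two units of the
  brick, although the closed units overlap.\<close>

definition unit_at :: "real^3 \<Rightarrow> cell" where
  "unit_at x = (\<lfloor>x $ 1 / 2\<rfloor>, \<lfloor>x $ 2 / 2\<rfloor>, \<lfloor>x $ 3\<rfloor>)"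

lemma mem_cbox3: "x \<in> cbox (vector [a, b, c]) (vector [a', b', c'] :: real^3) \<longleftrightarrow>
    a \<le> x $ 1 \<and> x $ 1 \<le> a' \<and> b \<le> x $ 2 \<and> x $ 2 \<le> b' \<and> c \<le> x $ 3 \<and> x $ 3 \<le> c'"
  by (auto simp: mem_box_cart forall_3)

lemma mem_box3: "x \<in> box (vector [a, b, c]) (vector [a', b', c'] :: real^3) \<longleftrightarrow>
    a < x $ 1 \<and> x $ 1 < a' \<and> b < x $ 2 \<and> x $ 2 < b' \<and> c < x $ 3 \<and> x $ 3 < c'"
  by (auto simp: mem_box_cart forall_3)

lemma qbox_pair_x: "qbox (i, j, h) \<union> qbox (i + 1, j, h) =
    cbox (vector [2 * of_int i, 2 * of_int j, of_int h])
     (vector [2 * of_int i + 4, 2 * of_int j + 2, of_int h + 1])"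
  by (auto simp: mem_cbox3)

lemma qbox_pair_y: "qbox (i, j, h) \<union> qbox (i, j + 1, h) =
    cbox (vector [2 * of_int i, 2 * of_int j, of_int h])
     (vector [2 * of_int i + 2, 2 * of_int j + 4, of_int h + 1])"
  by (auto simp: mem_cbox3)

text \<open>The two units of a brick are listed here from the smaller to the larger coordinate, which removes the
  sign of the direction from the unit to its mate.\<close>

lemma brick_cases:
  obtains i j h where "{u, mate J u} = {(i, j, h), (i + 1, j, h)}"
      "brick J u = cbox (vector [2 * of_int i, 2 * of_int j, of_int h])
        (vector [2 * of_int i + 4, 2 * of_int j + 2, of_int h + 1])"
  | i j h where "{u, mate J u} = {(i, j, h), (i, j + 1, h)}"
      "brick J u = cbox (vector [2 * of_int i, 2 * of_int j, of_int h])
        (vector [2 * of_int i + 2, 2 * of_int j + 4, of_int h + 1])"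
proof -
  obtain i j h where u: "u = (i, j, h)" by (cases u)
  show ?thesis
  proof (cases rule: mate_cases[of J i j h])
    case 1
    then show ?thesis using that(1)[of i j h] qbox_pair_x[of i j h] by (simp add: u brick_def)
  next
    case 2
    then show ?thesis using that(1)[of "i - 1" j h] qbox_pair_x[of "i - 1" j h]
      by (simp add: u brick_def insert_commute Un_commute)
  next
    case 3
    then show ?thesis using that(2)[of i j h] qbox_pair_y[of i j h] by (simp add: u brick_def)
  next
    case 4
    then show ?thesis using that(2)[of i "j - 1" h] qbox_pair_y[of i "j - 1" h]
      by (simp add: u brick_def insert_commute Un_commute)
  qed
qed

lemma vector3_plus: "vector [a, b, c] + vector [a', b', c'] = (vector [a + a', b + b', c + c'] :: real^3)"
  by (simp add: vec_eq_iff forall_3)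

lemma cbox_in_bricks:
  fixes l m n :: int
  shows "cbox (vector [of_int l, of_int m, of_int n])
      (vector [of_int l + 4, of_int m + 2, of_int n + 1]) \<in> bricks"
    and "cbox (vector [of_int l, of_int m, of_int n])
      (vector [of_int l + 2, of_int m + 4, of_int n + 1]) \<in> bricks"
proof -
  let ?v = "vector [of_int l, of_int m, of_int n] :: real^3"
  have "\<forall>i. ?v $ i \<in> \<int>" by (simp add: forall_3)
  then have "(\<lambda>x. ?v + x) ` B \<in> bricks"
    if "B \<in> {cbox 0 (vector [4, 2, 1]), cbox 0 (vector [2, 4, 1])}" for B
    using that unfolding bricks_def by blast
  then have "(\<lambda>x. ?v + x) ` cbox 0 (vector [4, 2, 1]) \<in> bricks"
    "(\<lambda>x. ?v + x) ` cbox 0 (vector [2, 4, 1]) \<in> bricks" by blast+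
  then show "cbox ?v (vector [of_int l + 4, of_int m + 2, of_int n + 1]) \<in> bricks"
    "cbox ?v (vector [of_int l + 2, of_int m + 4, of_int n + 1]) \<in> bricks"
    unfolding cbox_translation[symmetric] by (simp_all add: vector3_plus)
qed

lemma brick_in_bricks: "brick J u \<in> bricks"
proof (cases rule: brick_cases[of u J])
  case (1 i j h)
  then show ?thesis using cbox_in_bricks(1)[of "2 * i" "2 * j" h] by simp
next
  case (2 i j h)
  then show ?thesis using cbox_in_bricks(2)[of "2 * i" "2 * j" h] by simp
qed

lemma unit_at_interior_brick:
  assumes "x \<in> interior (brick J u)"
  shows "unit_at x \<in> {u, mate J u}"
proof -
  have fl: "\<lfloor>t / 2\<rfloor> = k \<longleftrightarrow> 2 * of_int k \<le> t \<and> t < 2 * of_int k + 2" for t :: real and k :: int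
    by (auto simp: floor_eq_iff)
  show ?thesis
  proof (cases rule: brick_cases[of u J])
    case (1 i j h)
    have "x \<in> box (vector [2 * of_int i, 2 * of_int j, of_int h])
        (vector [2 * of_int i + 4, 2 * of_int j + 2, of_int h + 1])"
      using assms 1(2) by (simp add: interior_cbox)
    then have "unit_at x \<in> {(i, j, h), (i + 1, j, h)}"
      unfolding mem_box3 unit_at_def by (auto simp: fl floor_eq_iff)
    then show ?thesis using 1 by simp
  next
    case (2 i j h)
    have "x \<in> box (vector [2 * of_int i, 2 * of_int j, of_int h])
        (vector [2 * of_int i + 2, 2 * of_int j + 4, of_int h + 1])"
      using assms 2(2) by (simp add: interior_cbox)
    then have "unit_at x \<in> {(i, j, h), (i, j + 1, h)}"
      unfolding mem_box3 unit_at_def by (auto simp: fl floor_eq_iff)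
    then show ?thesis using 2 by simp
  qed
qed

lemma brick_eqI:
  assumes "sym J" "w \<in> {u, mate J u}" "w \<in> {v, mate J v}"
  shows "brick J u = brick J v"
proof -
  have "brick J (mate J z) = brick J z" for z
    using mate_mate[OF assms(1)] by (auto simp: brick_def)
  then show ?thesis using assms(2,3) by (metis insertE empty_iff)
qed

text \<open>The centre of a unit lies in the interior of its brick, so the point set of a brick determines its
  two units. Without this, distinct dominoes might be counted as one brick.\<close>

lemma brick_eqD:
  assumes "brick J u = brick J v"
  shows "u \<in> {v, mate J v}"
proof -
  obtain i j h where u: "u = (i, j, h)" by (cases u)
  \<comment> \<open>the centre of the unit u\<close>
  define x :: "real^3" where
    "x = vector [2 * of_int i + 1, 2 * of_int j + 1, of_int h + 1 / 2]"
  have "x \<in> box (vector [2 * of_int i, 2 * of_int j, of_int h])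
     (vector [2 * of_int i + 2, 2 * of_int j + 2, of_int h + 1])"
    unfolding mem_box3 by (simp add: x_def)
  then have "x \<in> interior (qbox u)" by (simp add: u interior_cbox)
  then have "x \<in> interior (brick J u)"
    using interior_mono[of "qbox u" "brick J u"] by (auto simp: brick_def)
  then have "unit_at x \<in> {v, mate J v}" using assms unit_at_interior_brick by metis
  moreover have "unit_at x = u" by (simp add: unit_at_def x_def u floor_eq_iff)
  ultimately show ?thesis by simp
qed

lemma card_units:
  assumes "finite S"
  shows "finite (units S)" and "card (units S) = 16 * card S"
proof -
  let ?D = "S \<times> {0..1::int} \<times> {0..1::int} \<times> {0..3::int}"
  let ?f = "\<lambda>((a, b, c), i, j, k). (2 * a + i, 2 * b + j, 4 * c + k) :: cell"
  have inj: "inj_on ?f ?D"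
    by (rule inj_on_inverseI[where g = "\<lambda>(i, j, h).
      ((i div 2, j div 2, h div 4), i mod 2, j mod 2, h mod 4)"]) auto
  have img: "?f ` ?D = units S"
  proof (intro equalityI subsetI)
    fix u assume "u \<in> ?f ` ?D"
    then obtain a b c i j k where *: "(a, b, c) \<in> S" "0 \<le> i" "i \<le> 1" "0 \<le> j" "j \<le> 1" "0 \<le> k" "k \<le> 3"
      "u = (2 * a + i, 2 * b + j, 4 * c + k)" by auto
    have "(2 * a + i) div 2 = a" "(2 * b + j) div 2 = b" "(4 * c + k) div 4 = c"
      using * by presburger+
    then show "u \<in> units S" using * by (simp add: units_def quarters_def)
  next
    fix u assume u: "u \<in> units S"
    obtain i j h where ij: "u = (i, j, h)" by (cases u)
    have "u = ?f ((i div 2, j div 2, h div 4), i mod 2, j mod 2, h mod 4)" by (simp add: ij)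
    moreover have "((i div 2, j div 2, h div 4), i mod 2, j mod 2, h mod 4) \<in> ?D"
      using u by (auto simp: ij units_def quarters_def)
    ultimately show "u \<in> ?f ` ?D" by (rule image_eqI)
  qed
  show "finite (units S)" unfolding img[symmetric] using assms by simp
  show "card (units S) = 16 * card S"
    unfolding img[symmetric] card_image[OF inj] by (simp add: card_cartesian_product)
qed

text \<open>Each cube contributes \<open>2 \<times> 2 \<times> 4\<close> units, and every brick consists of two of them.\<close>

lemma card_brick_image:
  assumes "finite S" "sym J" "J \<subseteq> S \<times> S"
  shows "card (brick J ` units S) = 8 * card S"
proof -
  have fibre: "{u \<in> units S. brick J u = brick J v} = {v, mate J v}" if "v \<in> units S" for v
    using that mate_in_units[OF assms(3)] brick_eqD brick_eqI[OF assms(2)] by blast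
  have "16 * card S = (\<Sum>u\<in>units S. 1)" using card_units assms(1) by simp
  also have "\<dots> = (\<Sum>t\<in>brick J ` units S. \<Sum>u\<in>{u \<in> units S. brick J u = t}. 1)"
    by (rule sum.image_gen[OF card_units(1)[OF assms(1)]])
  also have "\<dots> = (\<Sum>t\<in>brick J ` units S. 2)"
  proof (rule sum.cong[OF refl])
    fix t assume "t \<in> brick J ` units S"
    then obtain v where v: "v \<in> units S" "t = brick J v" by blast
    have "card {v, mate J v} = 2" using mate_neq[of J v] by auto
    then show "(\<Sum>u\<in>{u \<in> units S. brick J u = t}. 1) = (2::nat)"
      unfolding v(2) fibre[OF v(1)] by simp
  qed
  finally show ?thesis by simp
qed

lemma scaled_cube: "(\<lambda>x. 4 *\<^sub>R x) ` cube s = \<Union> (qbox ` units {s})"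
proof -
  obtain a b c where s: "s = (a, b, c)" by (cases s)
  show ?thesis
  proof (intro equalityI subsetI)
    fix y assume "y \<in> (\<lambda>x. 4 *\<^sub>R x) ` cube s"
    then have y: "4 * of_int a \<le> y $ 1" "y $ 1 \<le> 4 * of_int a + 4" "4 * of_int b \<le> y $ 2"
      "y $ 2 \<le> 4 * of_int b + 4" "4 * of_int c \<le> y $ 3" "y $ 3 \<le> 4 * of_int c + 4"
      by (auto simp: s mem_cbox3)
    \<comment> \<open>on a wall between two units either one would do; the last wall must not round upwards out of the cube\<close>
    define i where "i = (if y $ 1 \<le> 4 * of_int a + 2 then 2 * a else 2 * a + 1)"
    define j where "j = (if y $ 2 \<le> 4 * of_int b + 2 then 2 * b else 2 * b + 1)"
    define h where "h = (if y $ 3 = 4 * of_int c + 4 then 4 * c + 3 else \<lfloor>y $ 3\<rfloor>)"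
    have h: "of_int h \<le> y $ 3" "y $ 3 \<le> of_int h + 1" "4 * c \<le> h" "h < 4 * c + 4"
      using y(5,6) unfolding h_def by (auto simp: le_floor_iff floor_less_iff)
    have "h div 4 = c" using h by presburger
    moreover have "i div 2 = a" "j div 2 = b" by (auto simp: i_def j_def)
    ultimately have "(i, j, h) \<in> units {s}" by (simp add: units_def quarters_def s)
    moreover have "y \<in> qbox (i, j, h)"
      using y h by (auto simp: mem_cbox3 i_def j_def)
    ultimately show "y \<in> \<Union> (qbox ` units {s})" by blast
  next
    fix y assume "y \<in> \<Union> (qbox ` units {s})"
    then obtain i j h where *: "i div 2 = a" "j div 2 = b" "h div 4 = c" "y \<in> qbox (i, j, h)"
      by (auto simp: units_def quarters_def s)
    have "2 * a \<le> i" "i \<le> 2 * a + 1" "2 * b \<le> j" "j \<le> 2 * b + 1" "4 * c \<le> h" "h \<le> 4 * c + 3"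
      using * by presburger+
    then have "2 * of_int a \<le> real_of_int i" "real_of_int i \<le> 2 * of_int a + 1"
      "2 * of_int b \<le> real_of_int j" "real_of_int j \<le> 2 * of_int b + 1"
      "4 * of_int c \<le> real_of_int h" "real_of_int h \<le> 4 * of_int c + 3"
      by linarith+
    then have "(1 / 4) *\<^sub>R y \<in> cube s" using *(4) by (auto simp: s mem_cbox3)
    then have "4 *\<^sub>R (1 / 4) *\<^sub>R y \<in> (\<lambda>x. 4 *\<^sub>R x) ` cube s" by (rule imageI)
    then show "y \<in> (\<lambda>x. 4 *\<^sub>R x) ` cube s" by simp
  qed
qed

lemma exact_tiling_brick_image:
  assumes "finite S" "sym J" "J \<subseteq> S \<times> S"
  shows "exact_tiling (brick J ` units S) ((\<lambda>x. 4 *\<^sub>R x) ` \<Union> (cube ` S))"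
proof -
  have "pairwise (\<lambda>A B. interior A \<inter> interior B = {}) (brick J ` units S)"
  proof (rule pairwiseI)
    fix A B assume "A \<in> brick J ` units S" "B \<in> brick J ` units S" "A \<noteq> B"
    then obtain u v where uv: "A = brick J u" "B = brick J v" "brick J u \<noteq> brick J v" by blast
    have False if "x \<in> interior A" "x \<in> interior B" for x
      using brick_eqI[OF assms(2) unit_at_interior_brick unit_at_interior_brick] that uv by simp
    then show "interior A \<inter> interior B = {}" by blast
  qed
  moreover have "\<Union> (brick J ` units S) = (\<lambda>x. 4 *\<^sub>R x) ` \<Union> (cube ` S)"
  proof -
    have "\<Union> (brick J ` units S) = \<Union> (qbox ` units S)"
    proof (intro equalityI subsetI)
      fix x assume "x \<in> \<Union> (brick J ` units S)"
      then obtain u where u: "u \<in> units S" "x \<in> qbox u \<or> x \<in> qbox (mate J u)"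
        unfolding brick_def by blast
      with mate_in_units[OF assms(3) u(1)] show "x \<in> \<Union> (qbox ` units S)" by blast
    qed (auto simp: brick_def)
    also have "\<dots> = (\<Union>s\<in>S. \<Union> (qbox ` units {s}))"
    proof -
      have "units S = (\<Union>s\<in>S. units {s})" by (auto simp: units_def quarters_def)
      then show ?thesis by (rule ssubst[where P = "\<lambda>U. \<Union> (qbox ` U) = _"]) blast
    qed
    finally have "\<Union> (brick J ` units S) = (\<Union>s\<in>S. \<Union> (qbox ` units {s}))" .
    then show ?thesis by (simp add: image_UN scaled_cube)
  qed
  ultimately show ?thesis
    unfolding exact_tiling_def using card_units(1)[OF assms(1)] brick_in_bricks by auto
qed

section \<open>Contacts\<close>

lemma height_interval_qbox: "height_interval (qbox (i, j, h)) = {of_int h .. of_int h + 1}"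
proof (intro equalityI subsetI)
  fix t assume "t \<in> {real_of_int h .. of_int h + 1}"
  then have "vector [2 * of_int i, 2 * of_int j, t] \<in> qbox (i, j, h)" by (simp add: mem_cbox3)
  then show "t \<in> height_interval (qbox (i, j, h))"
    unfolding height_interval_def by (metis image_eqI vector_3(3))
qed (auto simp: height_interval_def mem_cbox3)

lemma height_interval_brick: "height_interval (brick J (i, j, h)) = {of_int h .. of_int h + 1}"
proof -
  have "height_interval (brick J (i, j, h)) =
      height_interval (qbox (i, j, h)) \<union> height_interval (qbox (mate J (i, j, h)))"
    by (simp add: brick_def height_interval_def image_Un)
  then show ?thesis
    by (cases rule: mate_cases[of J i j h]) (simp_all only: height_interval_qbox Un_absorb)
qed

text \<open>A unit square of the unit \<open>(i, j, h)\<close> whose position does not depend on \<open>h\<close>: it is common to the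
  footprints of two bricks that contain units on top of each other.\<close>

lemma square_subset_footprint:
  "cbox (vector [2 * of_int i, 2 * of_int j]) (vector [2 * of_int i + 1, 2 * of_int j + 1])
     \<subseteq> footprint (brick J (i, j, h))"
proof
  fix z :: "real^2"
  assume z: "z \<in> cbox (vector [2 * of_int i, 2 * of_int j])
    (vector [2 * of_int i + 1, 2 * of_int j + 1])"
  have "vector [z $ 1, z $ 2, of_int h] \<in> qbox (i, j, h)"
    using z unfolding qbox.simps mem_cbox3 by (simp add: mem_box_cart forall_2)
  moreover have "z = vector [vector [z $ 1, z $ 2, of_int h :: real] $ (1::3),
      vector [z $ 1, z $ 2, of_int h :: real] $ (2::3)]"
    by (simp add: vec_eq_iff forall_2)
  ultimately show "z \<in> footprint (brick J (i, j, h))"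
    unfolding footprint_def brick_def by blast
qed

lemma contact_sym: "contact A B \<Longrightarrow> contact B A"
  unfolding contact_def by (auto simp: Int_commute)

lemma contact_brick: "contact (brick J (i, j, h)) (brick J (i, j, h + 1))"
proof -
  have "directly_below (brick J (i, j, h)) (brick J (i, j, h + 1))"
    unfolding directly_below_def height_interval_brick by (rule exI[of _ h]) (simp add: add.assoc)
  moreover have "cbox (vector [of_int (2 * i), of_int (2 * j)])
      (vector [of_int (2 * i) + 1, of_int (2 * j) + 1])
     \<subseteq> footprint (brick J (i, j, h)) \<inter> footprint (brick J (i, j, h + 1))"
    using square_subset_footprint[of i j J] by simp
  ultimately show ?thesis unfolding contact_def by blast
qed

text \<open>All bricks through one quarter column of a cube are stacked and hence linked, so a column may be
  represented by its lowest brick. A matched pair of columns shares a brick in some layer, the lowest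
  layer for \<open>ns\<close> and the one above it for \<open>ew\<close>. Thus every link between quarters lifts to a
  chain of contacts.\<close>

lemma contact_graph_connected_brick_image:
  assumes "linked S J"
  shows "contact_graph_connected (brick J ` units S)"
proof -
  have J: "sym J" "J \<subseteq> S \<times> S" "chain_connected (quarters S) (step J)"
    using assms unfolding linked_def by auto
  let ?T = "brick J ` units S"
  define K where "K = {(X, Y). X \<in> ?T \<and> Y \<in> ?T \<and> contact X Y}\<^sup>*"
  have symK: "(A, B) \<in> K \<Longrightarrow> (B, A) \<in> K" for A B
    unfolding K_def by (rule chain_sym[OF contact_sym])
  have transK: "(A, B) \<in> K \<Longrightarrow> (B, C) \<in> K \<Longrightarrow> (A, C) \<in> K" for A B C
    unfolding K_def by (rule rtrancl_trans)
  have up: "(brick J (i, j, h), brick J (i, j, h + 1)) \<in> K"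
    if "(i, j, h div 4) \<in> quarters S" "(i, j, (h + 1) div 4) \<in> quarters S" for i j h
    using that contact_brick[of J i j h] unfolding K_def by (auto simp: units_def)
  have column: "(brick J (i, j, 4 * c), brick J (i, j, 4 * c + int n)) \<in> K"
    if "(i, j, c) \<in> quarters S" "n < 4" for i j c n
    using that(2)
  proof (induction n)
    case 0
    then show ?case by (simp add: K_def)
  next
    case (Suc n)
    have "(4 * c + int n) div 4 = c" "(4 * c + int n + 1) div 4 = c" using Suc.prems by presburger+
    then have "(brick J (i, j, 4 * c + int n), brick J (i, j, 4 * c + int n + 1)) \<in> K"
      using up that(1) by simp
    from transK[OF Suc.IH this] Suc.prems show ?case by (simp add: ac_simps)
  qed
  have above: "(brick J (i, j, 4 * c), brick J (i, j, 4 * (c + 1))) \<in> K"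
    if "(i, j, c) \<in> quarters S" "(i, j, c + 1) \<in> quarters S" for i j c
  proof -
    have "(4 * c + 3) div 4 = c" "(4 * c + 3 + 1) div 4 = c + 1" by presburger+
    then have "(brick J (i, j, 4 * c + 3), brick J (i, j, 4 * c + 3 + 1)) \<in> K"
      using up[of i j "4 * c + 3"] that by metis
    moreover have "(brick J (i, j, 4 * c), brick J (i, j, 4 * c + 3)) \<in> K"
      using column[OF that(1), of 3] by simp
    ultimately have "(brick J (i, j, 4 * c), brick J (i, j, 4 * c + 3 + 1)) \<in> K" by (rule transK[rotated])
    then show ?thesis by (simp add: algebra_simps)
  qed
  have mate_brick: "brick J (mate J u) = brick J u" for u
    using brick_eqI[OF J(1)] by blast
  have link: "(brick J (relayer (4 * snd (snd p)) p), brick J (relayer (4 * snd (snd q)) q)) \<in> K"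
    if pq: "p \<in> quarters S" "q \<in> quarters S" "step J p q" for p q
  proof -
    obtain i j c i' j' c' where p: "p = (i, j, c)" and q: "q = (i', j', c')"
      by (cases p; cases q)
    consider "ns J (i, j, c) = (i', j', c')" | "ew J (i, j, c) = (i', j', c')"
      | "i = i'" "j = j'" "c' = c + 1" | "i = i'" "j = j'" "c = c' + 1"
      using pq(3) unfolding p q step.simps by linarith
    then show ?thesis
    proof cases
      case 1
      then have "c' = c" using ns_height by blast
      then have "mate J (i, j, 4 * c) = (i', j', 4 * c')" using 1 by (simp del: ns.simps)
      then have "brick J (i, j, 4 * c) = brick J (i', j', 4 * c')" using mate_brick by metis
      then show ?thesis by (simp add: p q K_def)
    next
      case 2
      then have c: "c' = c" using ew_height by blast
      have "(4 * c + 1) div 4 = c" by presburger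
      then have "mate J (i, j, 4 * c + 1) = (i', j', 4 * c + 1)" using 2 c by (simp del: ew.simps)
      then have "brick J (i, j, 4 * c + 1) = brick J (i', j', 4 * c + 1)" using mate_brick by metis
      moreover have "(brick J (i, j, 4 * c), brick J (i, j, 4 * c + 1)) \<in> K"
        and rise: "(brick J (i', j', 4 * c), brick J (i', j', 4 * c + 1)) \<in> K"
        using column[of i j c 1] column[of i' j' c 1] pq(1,2) by (simp_all add: p q c)
      ultimately have "(brick J (i, j, 4 * c), brick J (i', j', 4 * c + 1)) \<in> K" by simp
      from transK[OF this symK[OF rise]] show ?thesis by (simp add: p q c)
    next
      case 3
      then show ?thesis using above[of i j c] pq(1,2) by (simp add: p q)
    next
      case 4
      then show ?thesis using symK[OF above[of i j c']] pq(1,2) by (simp add: p q)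
    qed
  qed
  have path: "(brick J (relayer (4 * snd (snd p)) p), brick J (relayer (4 * snd (snd q)) q)) \<in> K"
    if "(p, q) \<in> {(X, Y). X \<in> quarters S \<and> Y \<in> quarters S \<and> step J X Y}\<^sup>*" for p q
    using that
  proof induction
    case base
    then show ?case by (simp add: K_def)
  next
    case (step y z)
    then have "y \<in> quarters S" "z \<in> quarters S" "step J y z" by auto
    from transK[OF step.IH link[OF this]] show ?case .
  qed
  have bottom: "(brick J u, brick J (relayer (4 * snd (snd (quarter_of u))) u)) \<in> K" if "u \<in> units S" for u
  proof -
    obtain i j h where u: "u = (i, j, h)" by (cases u)
    have "(i, j, h div 4) \<in> quarters S" using that by (simp add: units_def u)
    moreover have "4 * (h div 4) + int (nat (h mod 4)) = h" "nat (h mod 4) < 4" by auto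
    ultimately have "(brick J (i, j, 4 * (h div 4)), brick J (i, j, h)) \<in> K"
      using column[of i j "h div 4" "nat (h mod 4)"] by metis
    then show ?thesis using symK by (simp add: u)
  qed
  have "(brick J u, brick J v) \<in> K" if "u \<in> units S" "v \<in> units S" for u v
  proof -
    have "(quarter_of u, quarter_of v) \<in> {(X, Y). X \<in> quarters S \<and> Y \<in> quarters S \<and> step J X Y}\<^sup>*"
      using J(3) that unfolding chain_connected_def units_def by blast
    from path[OF this] have "(brick J (relayer (4 * snd (snd (quarter_of u))) u),
        brick J (relayer (4 * snd (snd (quarter_of v))) v)) \<in> K"
      by (cases u; cases v) simp
    from transK[OF transK[OF bottom[OF that(1)] this] symK[OF bottom[OF that(2)]]] show ?thesis .
  qed
  then show ?thesis unfolding contact_graph_connected_def chain_connected_def K_def[symmetric] by blast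
qed

section \<open>Models as sets of lattice cells\<close>

lemma unit_cubes_eq: "unit_cubes = range cube"
proof (intro equalityI subsetI)
  fix A assume "A \<in> range cube"
  then obtain a b c where "A = cube (a, b, c)" by auto
  then show "A \<in> unit_cubes" unfolding unit_cubes_def by auto
next
  fix A assume "A \<in> unit_cubes"
  then obtain a b c where "A = cube (a, b, c)" unfolding unit_cubes_def by auto
  then show "A \<in> range cube" by blast
qed

lemma inj_cube: "inj cube"
proof (rule injI)
  fix s t :: cell assume eq: "cube s = cube t"
  obtain a b c a' b' c' where s: "s = (a, b, c)" "t = (a', b', c')" by (cases s; cases t)
  have "vector [of_int a, of_int b, of_int c] \<in> cube s"
    "vector [of_int a', of_int b', of_int c'] \<in> cube t"
    by (simp_all add: s mem_cbox3)
  then have "vector [of_int a, of_int b, of_int c] \<in> cube t"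
    "vector [of_int a', of_int b', of_int c'] \<in> cube s"
    using eq by simp_all
  then show "s = t" by (auto simp: s mem_cbox3)
qed

text \<open>With two of three coordinates fixed, only a line is left.\<close>

lemma aff_dim_coordinates_fixed:
  fixes F :: "(real^3) set"
  assumes "m \<noteq> n" "\<And>x. x \<in> F \<Longrightarrow> x $ m = \<alpha>" "\<And>x. x \<in> F \<Longrightarrow> x $ n = \<beta>"
  shows "aff_dim F \<le> 1"
proof -
  obtain l :: 3 where l: "\<And>i. i = l \<or> i = m \<or> i = n"
    using assms(1) exhaust_3 by metis
  have "collinear F"
    unfolding collinear_def
  proof (intro exI ballI)
    fix x y assume "x \<in> F" "y \<in> F"
    then show "x - y = (x $ l - y $ l) *\<^sub>R axis l 1"
      using assms l by (auto simp: vec_eq_iff axis_def) (metis diff_self)+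
  qed
  then show ?thesis by (simp add: collinear_aff_dim)
qed

text \<open>A common face is contained in both cubes. In each direction in which the cubes differ, they can only
  meet in one coordinate plane; two such directions would confine the face to a line.\<close>

lemma share_face_near:
  assumes "share_face (cube s) (cube t)"
  shows "near s t"
proof -
  obtain a b c a' b' c' where s: "s = (a, b, c)" and t: "t = (a', b', c')" by (cases s; cases t)
  obtain F where F: "F face_of cube s" "F face_of cube t" "aff_dim F = 2"
    using assms unfolding share_face_def by blast
  have sub: "x \<in> cube s" "x \<in> cube t" if "x \<in> F" for x
    using F(1,2) that face_of_imp_subset by blast+
  obtain x where "x \<in> F" using F(3) by fastforce
  then have le: "\<bar>a - a'\<bar> \<le> 1" "\<bar>b - b'\<bar> \<le> 1" "\<bar>c - c'\<bar> \<le> 1"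
    using sub[of x] by (auto simp: s t mem_cbox3)
  have meet: "y = of_int (max m n)" if "m \<noteq> n"
    "of_int m \<le> y" "y \<le> of_int m + 1" "of_int n \<le> y" "y \<le> of_int n + 1"
    for m n :: int and y :: real
  proof (cases "m < n")
    case True
    then have "of_int m + 1 \<le> real_of_int n" by linarith
    then show ?thesis using that by linarith
  next
    case False
    then have "of_int n + 1 \<le> real_of_int m" using that(1) by linarith
    then show ?thesis using that False by (simp add: max_def)
  qed
  have coord: "a \<noteq> a' \<Longrightarrow> x $ 1 = of_int (max a a')" "b \<noteq> b' \<Longrightarrow> x $ 2 = of_int (max b b')"
    "c \<noteq> c' \<Longrightarrow> x $ 3 = of_int (max c c')" if "x \<in> F" for x
    using sub[OF that] unfolding s t cube.simps mem_cbox3 by (blast intro: meet)+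
  have "\<not> (a \<noteq> a' \<and> b \<noteq> b')" "\<not> (a \<noteq> a' \<and> c \<noteq> c')" "\<not> (b \<noteq> b' \<and> c \<noteq> c')"
    using aff_dim_coordinates_fixed[of 1 2 F, OF _ coord(1) coord(2)]
      aff_dim_coordinates_fixed[of 1 3 F, OF _ coord(1) coord(3)]
      aff_dim_coordinates_fixed[of 2 3 F, OF _ coord(2) coord(3)] F(3) by auto
  then show ?thesis using le by (auto simp: s t)
qed

lemma enlarged_model_tiling:
  assumes "model Q M" "face_connected Q"
  shows "\<exists>T. exact_tiling T ((\<lambda>x. 4 *\<^sub>R x) ` M) \<and> contact_graph_connected T \<and>
           card T = 8 * card Q"
proof -
  define S where "S = {s. cube s \<in> Q}"
  have Q: "Q = cube ` S" using assms(1) unfolding model_def unit_cubes_eq S_def by auto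
  have fin: "finite S" and card: "card Q = card S"
    using assms(1) inj_cube unfolding Q model_def
    by (auto simp: finite_image_iff card_image inj_on_subset)
  have "chain_connected S near"
    unfolding chain_connected_def
  proof (intro ballI)
    fix s t assume st: "s \<in> S" "t \<in> S"
    have "(A, B) \<in> {(X, Y). X \<in> Q \<and> Y \<in> Q \<and> share_face X Y}\<^sup>* \<Longrightarrow> A \<in> Q \<Longrightarrow>
       (inv cube A, inv cube B) \<in> {(X, Y). X \<in> S \<and> Y \<in> S \<and> near X Y}\<^sup>*" for A B
    proof (induction rule: rtrancl_induct)
      case (step B C)
      then obtain s t where "s \<in> S" "t \<in> S" "B = cube s" "C = cube t" "near s t"
        using share_face_near unfolding Q by blast
      then have "(inv cube B, inv cube C) \<in> {(X, Y). X \<in> S \<and> Y \<in> S \<and> near X Y}"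
        using inj_cube by simp
      with step.IH[OF step.prems] show ?case by (rule rtrancl_into_rtrancl)
    qed simp
    from this[of "cube s" "cube t"]
    show "(s, t) \<in> {(X, Y). X \<in> S \<and> Y \<in> S \<and> near X Y}\<^sup>*"
      using assms(2) st inj_cube unfolding face_connected_def chain_connected_def Q by simp
  qed
  moreover have "S \<noteq> {}" using assms(1) Q unfolding model_def by auto
  ultimately obtain J where J: "linked S J" using linked_exists fin by blast
  then have "sym J" "J \<subseteq> S \<times> S" unfolding linked_def by auto
  moreover have "M = \<Union> (cube ` S)" using assms(1) Q unfolding model_def by simp
  ultimately show ?thesis
    using exact_tiling_brick_image[OF fin] card_brick_image[OF fin]
      contact_graph_connected_brick_image[OF J] card by (intro exI[of _ "brick J ` units S"]) simp
qed

section \<open>Smaller factors\<close>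

text \<open>Any brick of the tiling has two corners whose first or second coordinates differ by 4.\<close>

lemma single_cube_no_tiling:
  fixes r :: real
  assumes "0 < r" "r < 4"
  shows "\<not> exact_tiling T ((\<lambda>x. r *\<^sub>R x) ` cube (0, 0, 0))"
proof
  assume T: "exact_tiling T ((\<lambda>x. r *\<^sub>R x) ` cube (0, 0, 0))"
  have "0 \<in> cube (0, 0, 0)" by (simp add: mem_cbox3)
  then obtain B where "B \<in> T" using T unfolding exact_tiling_def by fastforce
  then have "B \<in> bricks" and sub: "B \<subseteq> (\<lambda>x. r *\<^sub>R x) ` cube (0, 0, 0)"
    using T unfolding exact_tiling_def by auto
  have range: "0 \<le> x $ 1 \<and> x $ 1 \<le> r \<and> 0 \<le> x $ 2 \<and> x $ 2 \<le> r" if "x \<in> B" for x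
  proof -
    obtain y where "x = r *\<^sub>R y" "y \<in> cube (0, 0, 0)" using subsetD[OF sub \<open>x \<in> B\<close>] by (rule imageE)
    then show ?thesis using assms(1) by (auto simp: mem_cbox3)
  qed
  obtain v D where v: "B = (\<lambda>x. v + x) ` D"
    "D \<in> {cbox 0 (vector [4, 2, 1]), cbox 0 (vector [2, 4, 1])}"
    using \<open>B \<in> bricks\<close> unfolding bricks_def by blast
  have "0 \<in> D" using v(2) by (auto simp: mem_box_cart forall_3)
  then have "v \<in> B" using v(1) by force
  consider "vector [4, 2, 1] \<in> D" | "vector [2, 4, 1] \<in> D"
    using v(2) by (auto simp: mem_box_cart forall_3)
  then show False
  proof cases
    case 1
    then have "v + vector [4, 2, 1] \<in> B" using v(1) by blast
    from range[OF this] range[OF \<open>v \<in> B\<close>] show False using assms(2) by simp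
  next
    case 2
    then have "v + vector [2, 4, 1] \<in> B" using v(1) by blast
    from range[OF this] range[OF \<open>v \<in> B\<close>] show False using assms(2) by simp
  qed
qed

theorem theorem1:
  "(\<forall>Q M. model Q M \<and> face_connected Q \<longrightarrow>
      (\<exists>T. exact_tiling T ((\<lambda>x. 4 *\<^sub>R x) ` M) \<and> contact_graph_connected T \<and>
           card T = 8 * card Q)) \<and>
   (\<forall>r::real. 0 < r \<and> r < 4 \<longrightarrow>
      (\<exists>Q M. model Q M \<and> face_connected Q \<and>
         \<not> (\<exists>T. exact_tiling T ((\<lambda>x. r *\<^sub>R x) ` M) \<and> contact_graph_connected T)))"
proof (intro conjI allI impI)
  fix Q M assume "model Q M \<and> face_connected Q"
  then show "\<exists>T. exact_tiling T ((\<lambda>x. 4 *\<^sub>R x) ` M) \<and> contact_graph_connected T \<and>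
           card T = 8 * card Q"
    using enlarged_model_tiling by blast
next
  fix r :: real assume r: "0 < r \<and> r < 4"
  let ?c = "cube (0, 0, 0)"
  have "model {?c} ?c" unfolding model_def unit_cubes_eq by blast
  moreover have "face_connected {?c}" unfolding face_connected_def chain_connected_def by simp
  ultimately show "\<exists>Q M. model Q M \<and> face_connected Q \<and>
         \<not> (\<exists>T. exact_tiling T ((\<lambda>x. r *\<^sub>R x) ` M) \<and> contact_graph_connected T)"
    using single_cube_no_tiling r by blast
qed

end
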